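(* There are universal constants $C,c>0$ such that the following holds. Let $A$ be the adjacency matrix of an inhomogeneous directed Erdős–Rényi graph on $n$ vertices with edge probabilities $(p_{ij})_{1\le i,j\le n}$, and set $$d=\max_i\sum_j p_{ij},\qquad \kappa=\frac{\max_{i,j}p_{ij}}{d/n},\qquad q=\min\{\sqrt d,\ n^{1/10}\kappa^{-1/9}\}.$$ If $q\ge 1$, then for all $\varepsilon\ge 0$ $$\mathbb{P}\Big(\rho\big(d^{-1/2}(A-\mathbb{E}A)\big)\ge 1+\varepsilon\Big)\le C\,n^{2-c\,q\log(1+\varepsilon)}.$$ If $$d\ge 1\qquad\text{and}\qquad d^{7/2}\max_{i,j}p_{ij}\le n^{-1/10},$$ then for all $\varepsilon\ge 0$ $$\mathbb{P}\Big(\rho\big(d^{-1/2}(A-\mathbb{E}A)\big)\ge 1+\varepsilon\Big)\le C\,n^{2-c\sqrt d\,\log(1+\varepsilon)}.$$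
   Context: Inhomogeneous directed Erdős–Rényi graph: on vertex set $\{1,\dots,n\}$, each directed edge $(i,j)$, $1\le i,j\le n$, is included with probability $p_{ij}\in[0,1]$, independently of the others; $A$ is its adjacency matrix, i.e. $A_{ij}=1$ if $(i,j)$ is included and $A_{ij}=0$ otherwise. It is assumed that $d>0$, so that $\kappa$ is well defined. For a square matrix $M$, $\rho(M)=\max_{\lambda\in\sigma(M)}|\lambda|$ denotes its spectral radius. *)

theory Defs
  imports "HOL-Probability.Probability" "Jordan_Normal_Form.Spectral_Radius"
begin

(* The vertex set is {0..<n} instead of {1,...,n}, matching the 0-based indices of the
   matrix library.  An outcome g says for every pair (i, j) whether the directed edge from
   i to j is present; all pairs, including the loops (i, i), are sampled independently.
   Outside {0..<n} x {0..<n} the outcome is constantly False.  As bernoulli_pmf clamps its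
   parameter to [0, 1], edge_probs has to be assumed whenever this law is used. *)

definition edge_probs :: "nat \<Rightarrow> (nat \<Rightarrow> nat \<Rightarrow> real) \<Rightarrow> bool" where
  "edge_probs n p \<longleftrightarrow> (\<forall>i<n. \<forall>j<n. 0 \<le> p i j \<and> p i j \<le> 1)"

definition directed_ER :: "nat \<Rightarrow> (nat \<Rightarrow> nat \<Rightarrow> real) \<Rightarrow> (nat \<times> nat \<Rightarrow> bool) pmf" where
  "directed_ER n p = Pi_pmf ({0..<n} \<times> {0..<n}) False (\<lambda>(i, j). bernoulli_pmf (p i j))"

definition adjacency :: "nat \<Rightarrow> (nat \<times> nat \<Rightarrow> bool) \<Rightarrow> real mat" where
  "adjacency n g = mat n n (\<lambda>(i, j). if g (i, j) then 1 else 0)"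

definition mean_adjacency :: "nat \<Rightarrow> (nat \<Rightarrow> nat \<Rightarrow> real) \<Rightarrow> real mat" where
  "mean_adjacency n p =
     mat n n (\<lambda>(i, j). measure_pmf.expectation (directed_ER n p) (\<lambda>g. adjacency n g $$ (i, j)))"

(* The following maxima range over nonempty sets only for n > 0. *)

definition max_degree :: "nat \<Rightarrow> (nat \<Rightarrow> nat \<Rightarrow> real) \<Rightarrow> real" where
  "max_degree n p = Max ((\<lambda>i. \<Sum>j<n. p i j) ` {..<n})"

definition max_prob :: "nat \<Rightarrow> (nat \<Rightarrow> nat \<Rightarrow> real) \<Rightarrow> real" where
  "max_prob n p = Max ((\<lambda>(i, j). p i j) ` ({..<n} \<times> {..<n}))"

definition kappa :: "nat \<Rightarrow> (nat \<Rightarrow> nat \<Rightarrow> real) \<Rightarrow> real" where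
  "kappa n p = max_prob n p / (max_degree n p / real n)"

definition q_param :: "nat \<Rightarrow> (nat \<Rightarrow> nat \<Rightarrow> real) \<Rightarrow> real" where
  "q_param n p =
     min (sqrt (max_degree n p)) (real n powr (1/10) * kappa n p powr (-1/9))"

definition normalized_adjacency ::
    "nat \<Rightarrow> (nat \<Rightarrow> nat \<Rightarrow> real) \<Rightarrow> (nat \<times> nat \<Rightarrow> bool) \<Rightarrow> real mat" where
  "normalized_adjacency n p g =
     (max_degree n p powr (-1/2)) \<cdot>\<^sub>m (adjacency n g - mean_adjacency n p)"

(* The spectrum consists of complex eigenvalues, so the real matrix is complexified. *)

definition spectral_radius_tail :: "nat \<Rightarrow> (nat \<Rightarrow> nat \<Rightarrow> real) \<Rightarrow> real \<Rightarrow> real" where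
  "spectral_radius_tail n p t =
     measure_pmf.prob (directed_ER n p)
       {g. spectral_radius (map_mat complex_of_real (normalized_adjacency n p g)) \<ge> t}"

end

theory Submission
  imports Defs
begin

text \<open>
The spectral radius \<open>\<rho>\<close> of the matrix \<open>X\<close> in question satisfies \<open>\<rho>^(2 l) \<le> F\<close>, where \<open>F\<close> is the
squared Frobenius norm of \<open>X^l\<close> (\<open>spectral_radius_power_le_walk_sums\<close>).  With \<open>l\<close> of order
\<open>q ln n\<close>, Markov's inequality gives the tail bounds as soon as the expectation of \<open>F\<close> is of order
\<open>n^2\<close>; it is even of order \<open>n\<close>.

Expanded, \<open>F\<close> is a sum over pairs of walks of length \<open>l\<close> with the same start and the same end.  As
the entries of \<open>X\<close> are independent and centred, only pairs that use every edge at least twice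
contribute.  The variance of the entry at an edge is at most \<open>p / d\<close>, and such a term is at most
\<open>q^(-2 (l - e))\<close> times the product of these bounds over its \<open>e\<close> distinct edges
(\<open>expectation_edge_list\<close>).  The bounds in a row add up to at most one, so an edge that
leads to a new vertex costs nothing in the sum over all pairs, whereas an edge that leads back to a
visited vertex gains a factor \<open>b\<close>, the maximum of all these bounds, because its target is one of
few vertices.

Instead of enumerating the shapes of the pairs, each term is compared with the weight of a nearly
random exploration of the graph that the two walks discover.  This weight is a product over the
steps, and at each step the weights of all possible continuations add up to at most \<open>1 + 1 / l\<close>
(\<open>sum_step_weight_le\<close>), so that the total weight of all pairs is of order \<open>n\<close>
(\<open>sum_explore_weight_le\<close>).  The comparison (\<open>walk_pair_term_le_explore_weight\<close>) uses that the walks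
are directed: every visited vertex except the common end is left again, so if \<open>g\<close> edges lead back
to visited vertices, then the out-degrees exceed one by at most \<open>g\<close> in total.  Branchings are
therefore rare, and only there does a walk have a choice.  For \<open>g = 0\<close> the two walks coincide and
there is no choice at all.  For \<open>g \<ge> 1\<close> the choices cost a factor \<open>(b (2 l)^7 exp (4 l / q))^g\<close>,
which is at most one under the sparsity condition \<open>b q^7 \<le> n^(-1/10)\<close> if \<open>l\<close> is a small multiple
of \<open>q ln n\<close>.

Both assertions follow (\<open>tail_bound_of_sparse\<close>): the definition of the parameter \<open>q\<close> makes
\<open>b q^9\<close>, and hence \<open>b q^7\<close>, at most \<open>n^(-1/10)\<close> because \<open>\<kappa>\<close> is \<open>n b\<close>, and the second hypothesis
gives the sparsity condition for the square root of \<open>d\<close> in place of \<open>q\<close>.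
\<close>

section \<open>Walks\<close>

definition words :: "nat \<Rightarrow> nat \<Rightarrow> nat list set" where
  "words n l = {xs. set xs \<subseteq> {..<n} \<and> length xs = l}"

fun walk_edges :: "'a \<Rightarrow> 'a list \<Rightarrow> ('a \<times> 'a) list" where
  "walk_edges i [] = []"
| "walk_edges i (x # xs) = (i, x) # walk_edges x xs"

lemma finite_words [simp]: "finite (words n l)"
  unfolding words_def by (rule finite_lists_length_eq) simp

lemma words_0 [simp]: "words n 0 = {[]}"
  by (auto simp: words_def)

lemma sum_words_Suc: "(\<Sum>xs\<in>words n (Suc l). f xs) = (\<Sum>x<n. \<Sum>xs\<in>words n l. f (x # xs))"
proof -
  have "(\<Sum>xs\<in>words n (Suc l). f xs) = (\<Sum>(xs, x)\<in>words n l \<times> {..<n}. f (x # xs))"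
    unfolding words_def lists_length_Suc_eq
    by (subst sum.reindex) (auto simp: inj_on_def case_prod_unfold)
  also have "\<dots> = (\<Sum>x<n. \<Sum>xs\<in>words n l. f (x # xs))"
    by (subst sum.swap) (simp add: sum.cartesian_product)
  finally show ?thesis .
qed

lemma length_walk_edges [simp]: "length (walk_edges i xs) = length xs"
  by (induction i xs rule: walk_edges.induct) auto

lemma map_snd_walk_edges: "map snd (walk_edges i xs) = xs"
  by (induction i xs rule: walk_edges.induct) auto

lemma map_fst_walk_edges: "map fst (walk_edges i xs) = butlast (i # xs)"
  by (induction i xs rule: walk_edges.induct) auto

text \<open>
A walk leaves every vertex that it visits, except possibly its last one.  This is the only
property of walks behind the comparison of a pair of walks with its exploration weight.
\<close>

lemma walk_edges_sources:
  "set (i # xs) \<subseteq> insert (last (i # xs)) (fst ` set (walk_edges i xs))"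
proof -
  have "set (i # xs) = set (butlast (i # xs) @ [last (i # xs)])"
    by (simp only: append_butlast_last_id list.distinct not_False_eq_True)
  also have "\<dots> = insert (last (i # xs)) (set (map fst (walk_edges i xs)))"
    unfolding map_fst_walk_edges by simp
  finally show ?thesis by simp
qed

lemma walk_edges_subset:
  assumes "i < n" "xs \<in> words n l"
  shows "set (walk_edges i xs) \<subseteq> {0..<n} \<times> {0..<n}"
  using assms
proof (induction xs arbitrary: i l)
  case (Cons x xs)
  then have "x < n" "xs \<in> words n (length xs)" by (auto simp: words_def)
  with Cons.IH[of x "length xs"] Cons.prems(1) show ?case by auto
qed simp

section \<open>Exploration weights\<close>

definition out_nbrs :: "('a \<times> 'a) list \<Rightarrow> 'a \<Rightarrow> 'a set" where
  "out_nbrs h u = {v. (u, v) \<in> set h}"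

definition visited :: "'a \<Rightarrow> ('a \<times> 'a) list \<Rightarrow> 'a set" where
  "visited r h = insert r (snd ` set h)"

text \<open>
The weight of following the edge \<open>e\<close> after the edges in \<open>h\<close> have been explored from the root \<open>r\<close>.
Up to terms of order \<open>1 / L\<close> it is a sub-probability.  A known edge is chosen uniformly among the
known edges that leave the current vertex.  A new edge is charged \<open>s\<close>, a bound on its variance.  If it leads
to a visited vertex, it closes a loop in the explored graph: its target is one of at most \<open>L\<close>
vertices and its charge is at most \<open>b\<close>, so that after division by \<open>b * L\<^sup>2\<close> all such edges
together weigh at most \<open>1 / L\<close>.  If it leads to a new vertex, it costs nothing more when the
current vertex has not been left before, and a factor \<open>1 / L\<close> when it creates a branching.
\<close>

definition step_weight ::
    "('a \<times> 'a \<Rightarrow> real) \<Rightarrow> real \<Rightarrow> real \<Rightarrow> 'a \<Rightarrow> ('a \<times> 'a) list \<Rightarrow> 'a \<times> 'a \<Rightarrow> real" where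
  "step_weight s b L r h e =
     (if e \<in> set h then 1 / card (out_nbrs h (fst e))
      else s e * (if snd e \<in> visited r h then 1 / (b * L\<^sup>2)
                  else if out_nbrs h (fst e) = {} then 1 else 1 / L))"

fun explore_weight ::
    "('a \<times> 'a \<Rightarrow> real) \<Rightarrow> real \<Rightarrow> real \<Rightarrow> 'a \<Rightarrow> ('a \<times> 'a) list \<Rightarrow> ('a \<times> 'a) list \<Rightarrow> real" where
  "explore_weight s b L r h [] = 1"
| "explore_weight s b L r h (e # es) =
     step_weight s b L r h e * explore_weight s b L r (h @ [e]) es"

lemma explore_weight_append:
  "explore_weight s b L r h (es @ fs) =
     explore_weight s b L r h es * explore_weight s b L r (h @ es) fs"
  by (induction es arbitrary: h) (auto simp: mult_ac)

lemma finite_out_nbrs [simp]: "finite (out_nbrs h u)"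
proof -
  have "out_nbrs h u = snd ` (set h \<inter> {u} \<times> UNIV)"
    by (force simp: out_nbrs_def)
  then show ?thesis by simp
qed

lemma finite_visited [simp]: "finite (visited r h)"
  by (simp add: visited_def)

lemma card_visited: "card (visited r h) \<le> Suc (card (set h))"
  by (simp add: visited_def card_insert_if card_image_le le_SucI)

lemma step_weight_nonneg:
  assumes "0 \<le> s e" "0 \<le> b" "0 \<le> L"
  shows "0 \<le> step_weight s b L r h e"
  using assms by (auto simp: step_weight_def)

lemma explore_weight_nonneg:
  assumes "\<And>e. e \<in> set es \<Longrightarrow> 0 \<le> s e" "0 \<le> b" "0 \<le> L"
  shows "0 \<le> explore_weight s b L r h es"
  using assms(1) by (induction es arbitrary: h) (auto intro!: mult_nonneg_nonneg step_weight_nonneg assms(2,3))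

text \<open>
A vertex that has not been left before offers no known edge, and its new edges to new vertices
weigh at most one.  At any other vertex the known edges weigh at most one and the new branches
at most \<open>1 / L\<close>.  The edges that close a loop add another \<open>1 / L\<close> in both cases.
\<close>

lemma sum_step_weight_le:
  fixes s :: "nat \<times> nat \<Rightarrow> real" and L :: nat
  assumes s0: "\<And>v. v < n \<Longrightarrow> 0 \<le> s (u, v)" and sb: "\<And>v. v < n \<Longrightarrow> s (u, v) \<le> b"
    and row: "(\<Sum>v<n. s (u, v)) \<le> 1" and b: "0 < b" and h: "length h < L"
  shows "(\<Sum>v<n. step_weight s b L r h (u, v)) \<le> 1 + 2 / L"
proof -
  let ?T = "out_nbrs h u" and ?V = "visited r h"
  have L: "1 \<le> L" using h by simp
  have pt: "step_weight s b L r h (u, v) \<le> of_bool (v \<in> ?T) / card ?T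
      + s (u, v) * (if ?T = {} then 1 else 1 / L) + of_bool (v \<in> ?V) / (real L)\<^sup>2"
    if v: "v < n" for v
  proof (cases "(u, v) \<in> set h")
    case True
    then show ?thesis using s0[OF v] by (auto simp: step_weight_def out_nbrs_def)
  next
    case False
    have "s (u, v) / (b * (real L)\<^sup>2) \<le> 1 / (real L)\<^sup>2"
      using sb[OF v] b L by (simp add: field_simps)
    then have "s (u, v) / (b * (real L)\<^sup>2) \<le> 1 / card ?T + s (u, v) / real L + 1 / (real L)\<^sup>2"
      and "s (u, v) / (b * (real L)\<^sup>2) \<le> s (u, v) / real L + 1 / (real L)\<^sup>2"
      and "s (u, v) / (b * (real L)\<^sup>2) \<le> s (u, v) + 1 / (real L)\<^sup>2"
      using s0[OF v] by (auto intro: add_increasing)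
    then show ?thesis using False s0[OF v] by (auto simp: step_weight_def)
  qed
  have "(\<Sum>v<n. step_weight s b L r h (u, v)) \<le> (\<Sum>v<n. of_bool (v \<in> ?T) / card ?T
      + s (u, v) * (if ?T = {} then 1 else 1 / L) + of_bool (v \<in> ?V) / (real L)\<^sup>2)"
    by (intro sum_mono pt) simp
  also have "\<dots> = card ({..<n} \<inter> ?T) / card ?T + (\<Sum>v<n. s (u, v)) * (if ?T = {} then 1 else 1 / L)
      + card ({..<n} \<inter> ?V) / (real L)\<^sup>2"
    by (simp add: sum.distrib sum_distrib_right flip: sum_divide_distrib)
  also have "\<dots> \<le> (if ?T = {} then 0 else 1) + 1 * (if ?T = {} then 1 else 1 / L) + 1 / L"
  proof (intro add_mono mult_right_mono row)
    show "card ({..<n} \<inter> ?T) / card ?T \<le> (if ?T = {} then 0 else 1)"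
      by (auto simp: divide_le_eq card_mono)
    have "card ({..<n} \<inter> ?V) \<le> card ?V" by (intro card_mono) auto
    also have "\<dots> \<le> L" using card_visited[of r h] card_length[of h] h by linarith
    finally show "card ({..<n} \<inter> ?V) / (real L)\<^sup>2 \<le> 1 / L"
      using L by (simp add: field_simps power2_eq_square)
  qed auto
  also have "\<dots> \<le> 1 + 2 / L" by (auto simp: divide_right_mono)
  finally show ?thesis .
qed

lemma sum_explore_weight_le:
  fixes s :: "nat \<times> nat \<Rightarrow> real" and L :: nat
  assumes s0: "\<And>u v. u < n \<Longrightarrow> v < n \<Longrightarrow> 0 \<le> s (u, v)"
    and sb: "\<And>u v. u < n \<Longrightarrow> v < n \<Longrightarrow> s (u, v) \<le> b"
    and row: "\<And>u. u < n \<Longrightarrow> (\<Sum>v<n. s (u, v)) \<le> 1" and b: "0 < b"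
    and i: "i < n" and h: "length h + l \<le> L"
  shows "(\<Sum>xs\<in>words n l. explore_weight s b L r h (walk_edges i xs)) \<le> (1 + 2 / L) ^ l"
  using i h
proof (induction l arbitrary: i h)
  case (Suc l)
  have "(\<Sum>xs\<in>words n (Suc l). explore_weight s b L r h (walk_edges i xs))
      = (\<Sum>x<n. step_weight s b L r h (i, x) *
          (\<Sum>xs\<in>words n l. explore_weight s b L r (h @ [(i, x)]) (walk_edges x xs)))"
    by (simp add: sum_words_Suc sum_distrib_left)
  also have "\<dots> \<le> (\<Sum>x<n. step_weight s b L r h (i, x) * (1 + 2 / L) ^ l)"
    using Suc.prems b
    by (intro sum_mono mult_left_mono Suc.IH step_weight_nonneg s0) auto
  also have "\<dots> = (\<Sum>x<n. step_weight s b L r h (i, x)) * (1 + 2 / L) ^ l"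
    by (simp add: sum_distrib_right)
  also have "\<dots> \<le> (1 + 2 / L) * (1 + 2 / L) ^ l"
    using Suc.prems by (intro mult_right_mono sum_step_weight_le s0 sb row b) auto
  finally show ?case by simp
qed simp

text \<open>
The price of replacing the product of the variance bounds by the exploration weight.  Each of the
\<open>card (set zs) + 1 - card (visited r zs)\<close> closed loops costs a factor \<open>b * L\<^sup>2\<close>.  Each branching
costs a factor \<open>L\<close>, and the branchings are at most as many as the edges in excess of their
sources.  A step along a known edge costs the current out-degree, which is one unless the current
vertex belongs to the set \<open>F\<close> of vertices that branch in the end.  Apart from the last one, these
exponents depend only on sets of edges and vertices, so the induction does not have to record how
the walk discovered them.
\<close>

lemma prod_le_explore_weight:
  fixes s :: "'a \<times> 'a \<Rightarrow> real" and D :: real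
  assumes s0: "\<And>e. e \<in> set zs \<Longrightarrow> 0 \<le> s e" and b: "0 < b" and L: "1 \<le> L" and D: "1 \<le> D"
    and F: "\<And>u. u \<notin> F \<Longrightarrow> card (out_nbrs zs u) \<le> 1"
    and deg: "\<And>u. card (out_nbrs zs u) \<le> D"
  shows "prod s (set zs) \<le> explore_weight s b L r [] zs
     * (b * L\<^sup>2) ^ (card (set zs) + 1 - card (visited r zs))
     * L ^ (card (set zs) - card (fst ` set zs))
     * D ^ length (filter (\<lambda>e. fst e \<in> F) zs)"
  using s0 F deg
proof (induction zs rule: rev_induct)
  case Nil
  then show ?case by (simp add: visited_def)
next
  case (snoc e zs)
  obtain u w where e: "e = (u, w)" by (cases e)
  let ?k = "\<lambda>zs. card (set zs) + 1 - card (visited r zs)"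
  let ?m = "\<lambda>zs. card (set zs) - card (fst ` set zs)"
  let ?R = "\<lambda>zs. length (filter (\<lambda>e. fst e \<in> F) zs)"
  let ?W = "explore_weight s b L r []"
  let ?B = "\<lambda>zs. ?W zs * (b * L\<^sup>2) ^ ?k zs * L ^ ?m zs * D ^ ?R zs"
  have mono: "card (out_nbrs zs v) \<le> card (out_nbrs (zs @ [e]) v)" for v
    by (intro card_mono finite_out_nbrs) (auto simp: out_nbrs_def)
  have IH: "prod s (set zs) \<le> ?B zs"
  proof (rule snoc.IH)
    show "card (out_nbrs zs v) \<le> 1" if "v \<notin> F" for v
      using snoc.prems(2)[OF that] mono[of v] by linarith
    show "card (out_nbrs zs v) \<le> D" for v
      using snoc.prems(3)[of v] mono[of v] by linarith
  qed (use snoc.prems in auto)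
  have W: "?W (zs @ [e]) = ?W zs * step_weight s b L r zs e"
    by (simp add: explore_weight_append)
  have W0: "0 \<le> ?W zs" using snoc.prems b L by (intro explore_weight_nonneg) auto
  have cf: "card (fst ` set zs) \<le> card (set zs)" by (simp add: card_image_le)
  have cv: "card (visited r zs) \<le> card (set zs) + 1" using card_visited[of r zs] by simp
  have se: "0 \<le> s e" using snoc.prems by simp
  have Rle: "D ^ ?R zs \<le> D ^ ?R (zs @ [e])" using D by (intro power_increasing) auto
  show ?case
  \<comment> \<open>A known edge leaves all sets unchanged, and \<open>D\<close> compensates for the choice among known edges.\<close>
  proof (cases "e \<in> set zs")
    case True
    then have eq: "set (zs @ [e]) = set zs" "visited r (zs @ [e]) = visited r zs"
      by (auto simp: visited_def)
    let ?c = "card (out_nbrs zs u)"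
    have "w \<in> out_nbrs zs u" using True e by (simp add: out_nbrs_def)
    then have c: "1 \<le> ?c" by (auto simp: Suc_le_eq card_gt_0_iff)
    have "D ^ ?R zs \<le> step_weight s b L r zs e * D ^ ?R (zs @ [e])"
    proof (cases "u \<in> F")
      case uF: True
      have "real ?c \<le> D" using snoc.prems(3)[of u] mono[of u] by linarith
      then have "1 \<le> D / ?c" using c by (simp add: field_simps)
      then have "D ^ ?R zs * 1 \<le> D ^ ?R zs * (D / ?c)" using D by (intro mult_left_mono) auto
      then show ?thesis using uF True e by (simp add: step_weight_def mult_ac)
    next
      case False
      then have "?c = 1" using snoc.prems(2)[of u] mono[of u] c by linarith
      then show ?thesis using False True e by (simp add: step_weight_def)
    qed
    then have "(?W zs * (b * L\<^sup>2) ^ ?k zs * L ^ ?m zs) * D ^ ?R zs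
        \<le> (?W zs * (b * L\<^sup>2) ^ ?k zs * L ^ ?m zs) * (step_weight s b L r zs e * D ^ ?R (zs @ [e]))"
      using W0 b L by (intro mult_left_mono) auto
    with IH show ?thesis unfolding W eq by (simp add: mult_ac)
  next
    case False
    have cs: "card (set (zs @ [e])) = Suc (card (set zs))" using False by simp
    have P: "prod s (set (zs @ [e])) = s e * prod s (set zs)" using False by simp
    have cf': "card (fst ` set (zs @ [e])) =
        card (fst ` set zs) + of_bool (out_nbrs zs u = {})"
      by (force simp: e out_nbrs_def card_insert_if)
    have step: "s e * ((b * L\<^sup>2) ^ ?k zs * L ^ ?m zs)
        \<le> step_weight s b L r zs e * ((b * L\<^sup>2) ^ ?k (zs @ [e]) * L ^ ?m (zs @ [e]))"
    \<comment> \<open>Closing a loop raises the exponent of \<open>b\<close>; a branching raises that of \<open>L\<close> only.\<close>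
    proof (cases "w \<in> visited r zs")
      case True
      then have v: "visited r (zs @ [e]) = visited r zs" by (auto simp: visited_def e)
      have k: "?k (zs @ [e]) = Suc (?k zs)" using cs cv by (simp add: v)
      have "L ^ ?m zs \<le> L ^ ?m (zs @ [e])"
        using L cf unfolding cs cf' by (intro power_increasing) auto
      then have "s e * (b * L\<^sup>2) ^ ?k zs * L ^ ?m zs \<le> s e * (b * L\<^sup>2) ^ ?k zs * L ^ ?m (zs @ [e])"
        using se b L by (intro mult_left_mono) auto
      also have "\<dots> = step_weight s b L r zs e * ((b * L\<^sup>2) ^ ?k (zs @ [e]) * L ^ ?m (zs @ [e]))"
        using True False b L unfolding k by (simp add: step_weight_def e)
      finally show ?thesis by (simp add: mult_ac)
    next
      case new: False
      then have v: "visited r (zs @ [e]) = insert w (visited r zs)" by (auto simp: visited_def e)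
      have k: "?k (zs @ [e]) = ?k zs" using cs new by (simp add: v)
      have "L ^ ?m (zs @ [e]) = L ^ ?m zs * (if out_nbrs zs u = {} then 1 else L)"
        unfolding cs cf' using cf by (simp add: Suc_diff_le)
      then show ?thesis using new False L unfolding k by (simp add: step_weight_def e)
    qed
    have "prod s (set (zs @ [e])) \<le> s e * ?B zs"
      unfolding P using IH se by (intro mult_left_mono)
    also have "\<dots> = ?W zs * D ^ ?R zs * (s e * ((b * L\<^sup>2) ^ ?k zs * L ^ ?m zs))"
      by (simp add: mult_ac)
    also have "\<dots> \<le> ?W zs * D ^ ?R zs *
        (step_weight s b L r zs e * ((b * L\<^sup>2) ^ ?k (zs @ [e]) * L ^ ?m (zs @ [e])))"
      using W0 D by (intro mult_left_mono step) auto
    also have "\<dots> \<le> ?W zs * D ^ ?R (zs @ [e]) *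
        (step_weight s b L r zs e * ((b * L\<^sup>2) ^ ?k (zs @ [e]) * L ^ ?m (zs @ [e])))"
      using W0 b L se Rle by (intro mult_right_mono mult_left_mono mult_nonneg_nonneg step_weight_nonneg) auto
    finally show ?thesis unfolding W by (simp add: mult_ac)
  qed
qed

section \<open>Pairs of walks in which every edge is repeated\<close>

lemma count_list_filter: "count_list (filter P zs) e = (if P e then count_list zs e else 0)"
  by (induction zs) auto

text \<open>
For the edges that do not start at a branching vertex this bounds the number of their steps from
below, and hence the number of all other steps from above.
\<close>

lemma two_card_le_length_filter:
  assumes "\<forall>e\<in>set zs. 2 \<le> count_list zs e"
  shows "2 * card {e \<in> set zs. P e} \<le> length (filter P zs)"
proof -
  have "2 * card {e \<in> set zs. P e} = (\<Sum>e\<in>set (filter P zs). 2)" by simp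
  also have "\<dots> \<le> (\<Sum>e\<in>set (filter P zs). count_list (filter P zs) e)"
    using assms by (intro sum_mono) (auto simp: count_list_filter)
  also have "\<dots> = length (filter P zs)" by (rule sum_count_set) auto
  finally show ?thesis .
qed

lemma set_eq_Sigma_out_nbrs: "{e \<in> set zs. fst e \<in> F} = Sigma (F \<inter> fst ` set zs) (out_nbrs zs)"
  by (force simp: out_nbrs_def)

lemma sum_out_nbrs_excess:
  "(\<Sum>u\<in>fst ` set zs. card (out_nbrs zs u) - 1) + card (fst ` set zs) = card (set zs)"
proof -
  have "1 \<le> card (out_nbrs zs u)" if "u \<in> fst ` set zs" for u
    using that by (auto simp: Suc_le_eq card_gt_0_iff) (auto simp: out_nbrs_def)
  then have "(\<Sum>u\<in>fst ` set zs. card (out_nbrs zs u) - 1) + (\<Sum>u\<in>fst ` set zs. 1)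
      = (\<Sum>u\<in>fst ` set zs. card (out_nbrs zs u))"
    unfolding sum.distrib[symmetric] by (intro sum.cong refl le_add_diff_inverse2)
  also have "\<dots> = card (Sigma (UNIV \<inter> fst ` set zs) (out_nbrs zs))" by simp
  also have "\<dots> = card (set zs)" unfolding set_eq_Sigma_out_nbrs[symmetric] by simp
  finally show ?thesis by simp
qed

text \<open>
Let \<open>e\<close> be the number of distinct edges and \<open>g\<close> the number of closed loops of the explored graph.
All visited vertices but \<open>t\<close> are left again, so there are at least \<open>e - g\<close> sources.  Hence the
out-degrees of the sources exceed one by at most \<open>g\<close> in total: each of them is at most \<open>g + 1\<close>,
and at most \<open>2 g\<close> edges start at a branching vertex.  As every edge is used at least twice, at most
\<open>4 g + 2 (l - e)\<close> steps start at a branching vertex.  With \<open>L = 2 l\<close>, the term is therefore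
at most the exploration weight times \<open>(b L^3 (g + 1)^4)^g ((g + 1) / q)^(2 (l - e))\<close>.

For \<open>g = 0\<close> this factor is at most one because of \<open>q \<ge> 1\<close>.  For \<open>g \<ge> 1\<close> the second power is at
most \<open>exp (4 l g / q)\<close> because of \<open>x \<le> exp x\<close>, and \<open>g + 1\<close> is at most \<open>L\<close>, so the factor is at most
\<open>(b L^7 exp (4 l / q))^g\<close>.
\<close>

lemma walk_pair_term_le_explore_weight:
  fixes s :: "'a \<times> 'a \<Rightarrow> real" and b q :: real and l :: nat
  assumes s0: "\<And>e. e \<in> set zs \<Longrightarrow> 0 \<le> s e" and b: "0 < b" and q: "1 \<le> q"
    and len: "length zs = 2 * l" and l: "1 \<le> l"
    and cnt: "\<forall>e\<in>set zs. 2 \<le> count_list zs e"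
    and src: "visited r zs \<subseteq> insert t (fst ` set zs)"
    and small: "b * real (2 * l) ^ 7 * exp (4 * real l / q) \<le> 1"
  shows "(1 / q) ^ (2 * l - 2 * card (set zs)) * prod s (set zs)
    \<le> explore_weight s b (2 * l) r [] zs"
proof -
  define e where "e = card (set zs)"
  define c where "c = card (fst ` set zs)"
  define g where "g = e + 1 - card (visited r zs)"
  define F where "F = {u. 2 \<le> card (out_nbrs zs u)}"
  define D where "D = real (g + 1)"
  define k where "k = 2 * l - 2 * e"
  define W where "W = explore_weight s b (2 * l) r [] zs"
  define L where "L = real (2 * l)"
  have "card (visited r zs) \<le> card (insert t (fst ` set zs))" using src by (intro card_mono) auto
  then have vc: "card (visited r zs) \<le> c + 1" by (simp add: c_def card_insert_if split: if_splits)
  have ec: "c \<le> e" unfolding c_def e_def by (rule card_image_le) simp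
  have exc: "(\<Sum>u\<in>fst ` set zs. card (out_nbrs zs u) - 1) = e - c"
    using sum_out_nbrs_excess[of zs] unfolding e_def c_def by simp
  have cg: "e - c \<le> g" using vc ec unfolding g_def by simp
  have deg: "card (out_nbrs zs u) \<le> g + 1" for u
  proof (cases "u \<in> fst ` set zs")
    case True
    then have "card (out_nbrs zs u) - 1 \<le> e - c"
      unfolding exc[symmetric] by (intro member_le_sum) auto
    with cg show ?thesis by simp
  next
    case False
    then have "out_nbrs zs u = {}" by (force simp: out_nbrs_def)
    then show ?thesis by simp
  qed
  have "card {e \<in> set zs. fst e \<in> F} = (\<Sum>u\<in>F \<inter> fst ` set zs. card (out_nbrs zs u))"
    unfolding set_eq_Sigma_out_nbrs by simp
  also have "\<dots> \<le> (\<Sum>u\<in>F \<inter> fst ` set zs. 2 * (card (out_nbrs zs u) - 1))"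
    by (intro sum_mono) (auto simp: F_def)
  also have "\<dots> \<le> (\<Sum>u\<in>fst ` set zs. 2 * (card (out_nbrs zs u) - 1))"
    by (intro sum_mono2) auto
  also have "\<dots> = 2 * (e - c)" unfolding exc[symmetric] by (simp add: sum_distrib_left)
  finally have branch: "card {e \<in> set zs. fst e \<in> F} \<le> 2 * g" using cg by simp
  have "e = card ({e \<in> set zs. fst e \<in> F} \<union> {e \<in> set zs. fst e \<notin> F})"
    unfolding e_def by (rule arg_cong[where f = card]) auto
  also have "\<dots> = card {e \<in> set zs. fst e \<in> F} + card {e \<in> set zs. fst e \<notin> F}"
    by (intro card_Un_disjoint) auto
  finally have split: "e = card {e \<in> set zs. fst e \<in> F} + card {e \<in> set zs. fst e \<notin> F}" .
  have el: "e \<le> l" using two_card_le_length_filter[OF cnt, of "\<lambda>_. True"] len by (simp add: e_def)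
  have steps: "length (filter (\<lambda>e. fst e \<in> F) zs) \<le> 4 * g + k"
    using two_card_le_length_filter[OF cnt, of "\<lambda>e. fst e \<notin> F"] split branch len
      sum_length_filter_compl[of "\<lambda>e. fst e \<in> F" zs] el unfolding k_def by linarith
  have D1: "1 \<le> D" and L1: "1 \<le> L" using l by (auto simp: D_def L_def)
  have DL: "D \<le> L"
  proof -
    have "card (visited r zs) \<ge> 1" by (simp add: Suc_le_eq card_gt_0_iff visited_def)
    then show ?thesis using el l by (simp add: D_def L_def g_def)
  qed
  have W0: "0 \<le> W" unfolding W_def using s0 b by (intro explore_weight_nonneg) auto
  have "prod s (set zs) \<le> W * (b * L\<^sup>2) ^ g * L ^ (e - c) * D ^ length (filter (\<lambda>e. fst e \<in> F) zs)"
    unfolding W_def L_def[symmetric] e_def c_def g_def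
    using s0 b L1 D1 of_nat_mono[OF deg, where 'a = real]
    by (intro prod_le_explore_weight) (auto simp: F_def D_def not_le)
  also have "\<dots> \<le> W * (b * L\<^sup>2) ^ g * L ^ g * D ^ (4 * g + k)"
  proof -
    have "L ^ (e - c) \<le> L ^ g" using L1 cg by (rule power_increasing[rotated])
    moreover have "D ^ length (filter (\<lambda>e. fst e \<in> F) zs) \<le> D ^ (4 * g + k)"
      using D1 steps by (rule power_increasing[rotated])
    ultimately show ?thesis using W0 b L1 D1 by (intro mult_mono mult_nonneg_nonneg) auto
  qed
  finally have "(1 / q) ^ k * prod s (set zs)
      \<le> (1 / q) ^ k * (W * (b * L\<^sup>2) ^ g * L ^ g * D ^ (4 * g + k))"
    using q by (intro mult_left_mono) auto
  also have "\<dots> = W * ((b * L ^ 3 * D ^ 4) ^ g * (D / q) ^ k)"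
  proof -
    have "(b * L ^ 3 * D ^ 4) ^ g = (b * L\<^sup>2 * L * D ^ 4) ^ g"
      by (simp add: power2_eq_square power3_eq_cube mult_ac)
    also have "\<dots> = (b * L\<^sup>2) ^ g * L ^ g * D ^ (4 * g)"
      by (simp only: power_mult_distrib power_mult)
    finally show ?thesis by (simp add: power_add power_divide)
  qed
  also have "\<dots> \<le> W * 1"
  proof (intro mult_left_mono W0)
    show "(b * L ^ 3 * D ^ 4) ^ g * (D / q) ^ k \<le> 1"
    proof (cases "g = 0")
      case True
      then show ?thesis using q by (simp add: D_def power_le_one)
    next
      case False
      have "(D / q) ^ k \<le> exp (D / q) ^ k"
        using order_trans[OF _ exp_ge_add_one_self, of "D / q" "D / q"] D1 q
        by (intro power_mono) auto
      also have "\<dots> \<le> exp (D / q) ^ (2 * l)"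
        using D1 q by (intro power_increasing) (auto simp: k_def)
      also have "\<dots> \<le> exp (2 * g / q) ^ (2 * l)"
        using False q by (intro power_mono) (auto simp: D_def divide_right_mono)
      also have "\<dots> = exp (4 * real l / q) ^ g"
        by (simp flip: exp_of_nat_mult add: field_simps)
      finally have E: "(D / q) ^ k \<le> exp (4 * real l / q) ^ g" .
      have "D ^ 4 \<le> L ^ 4" using D1 DL by (intro power_mono) auto
      then have "b * L ^ 3 * D ^ 4 \<le> b * L ^ 3 * L ^ 4" using b L1 by (intro mult_left_mono) auto
      also have "\<dots> = b * L ^ 7" by (simp flip: power_add)
      finally have "(b * L ^ 3 * D ^ 4) ^ g \<le> (b * L ^ 7) ^ g"
        using b L1 D1 by (intro power_mono) auto
      then have "(b * L ^ 3 * D ^ 4) ^ g * (D / q) ^ k \<le> (b * L ^ 7) ^ g * exp (4 * real l / q) ^ g"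
        using E b L1 D1 q by (intro mult_mono) auto
      also have "\<dots> = (b * L ^ 7 * exp (4 * real l / q)) ^ g" by (simp add: power_mult_distrib)
      also have "\<dots> \<le> 1" using small b L1 by (intro power_le_one) (auto simp: L_def)
      finally show ?thesis .
    qed
  qed
  finally show ?thesis unfolding W_def k_def e_def by simp
qed

section \<open>Eigenvalues and sums over walks\<close>

text \<open>
The entries of the \<open>l\<close>-th power of the matrix \<open>M\<close>, written as sums over walks.
\<close>

definition walk_sum :: "(nat \<times> nat \<Rightarrow> real) \<Rightarrow> nat \<Rightarrow> nat \<Rightarrow> nat \<Rightarrow> nat \<Rightarrow> real" where
  "walk_sum M n l i j =
     (\<Sum>xs\<in>words n l. of_bool (last (i # xs) = j) * prod_list (map M (walk_edges i xs)))"

lemma last_word_less: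
  assumes "i < n" "xs \<in> words n l"
  shows "last (i # xs) < n"
  using assms last_in_set[of "i # xs"] by (auto simp: words_def simp del: last.simps split: if_splits)

lemma eigenvector_walk_expansion:
  fixes v :: "nat \<Rightarrow> complex"
  assumes ev: "\<And>i. i < n \<Longrightarrow> (\<Sum>j<n. of_real (M (i, j)) * v j) = z * v i" and "i < n"
  shows "z ^ l * v i =
    (\<Sum>xs\<in>words n l. of_real (prod_list (map M (walk_edges i xs))) * v (last (i # xs)))"
  using assms(2)
proof (induction l arbitrary: i)
  case (Suc l)
  have "z ^ Suc l * v i = z ^ l * (z * v i)" by simp
  also have "\<dots> = (\<Sum>j<n. of_real (M (i, j)) * (z ^ l * v j))"
    unfolding ev[OF Suc.prems, symmetric] by (simp add: sum_distrib_left mult_ac)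
  also have "\<dots> = (\<Sum>j<n. of_real (M (i, j)) *
      (\<Sum>xs\<in>words n l. of_real (prod_list (map M (walk_edges j xs))) * v (last (j # xs))))"
    by (intro sum.cong refl arg_cong2[where f = "(*)"] Suc.IH) auto
  finally show ?case by (simp add: sum_words_Suc sum_distrib_left mult_ac del: last.simps)
      (simp add: mult_ac)
qed simp

lemma of_real_bool: "complex_of_real (of_bool P) = of_bool P"
  by (cases P) auto

text \<open>
The right-hand side is the squared Frobenius norm of the matrix power, which bounds its action on
an eigenvector.
\<close>

lemma eigenvalue_power_le_walk_sums:
  fixes v :: "nat \<Rightarrow> complex"
  assumes ev: "\<And>i. i < n \<Longrightarrow> (\<Sum>j<n. of_real (M (i, j)) * v j) = z * v i"
    and nz: "i0 < n" "v i0 \<noteq> 0"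
  shows "norm z ^ (2 * l) \<le> (\<Sum>i<n. \<Sum>j<n. (walk_sum M n l i j)\<^sup>2)"
proof -
  let ?N = "\<Sum>j<n. (norm (v j))\<^sup>2"
  have comp: "norm z ^ (2 * l) * (norm (v i))\<^sup>2 \<le> (\<Sum>j<n. (walk_sum M n l i j)\<^sup>2) * ?N"
    if i: "i < n" for i
  proof -
    have "z ^ l * v i =
        (\<Sum>xs\<in>words n l. \<Sum>j<n. of_bool (last (i # xs) = j) *
           (of_real (prod_list (map M (walk_edges i xs))) * v j))"
    proof (subst eigenvector_walk_expansion[OF ev i], assumption, intro sum.cong refl)
      fix xs assume "xs \<in> words n l"
      then have "last (i # xs) < n" by (rule last_word_less[OF i])
      then show "of_real (prod_list (map M (walk_edges i xs))) * v (last (i # xs)) =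
          (\<Sum>j<n. of_bool (last (i # xs) = j) * (of_real (prod_list (map M (walk_edges i xs))) * v j))"
        by (simp del: last.simps add: of_bool_def if_distrib[where f = "\<lambda>x. x * _"] cong: if_cong)
    qed
    also have "\<dots> = (\<Sum>j<n. of_real (walk_sum M n l i j) * v j)"
      by (subst sum.swap) (simp add: walk_sum_def of_real_bool sum_distrib_right sum_distrib_left mult_ac
          del: last.simps sum_of_bool_mult_eq sum_mult_of_bool_eq)
    finally have "norm (z ^ l * v i) \<le> (\<Sum>j<n. \<bar>walk_sum M n l i j\<bar> * norm (v j))"
      by (simp add: sum_norm_le norm_mult)
    then have "(norm (z ^ l * v i))\<^sup>2 \<le> (\<Sum>j<n. \<bar>walk_sum M n l i j\<bar> * norm (v j))\<^sup>2"
      by (intro power_mono) auto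
    also have "\<dots> \<le> (\<Sum>j<n. \<bar>walk_sum M n l i j\<bar>\<^sup>2) * ?N"
      by (rule Cauchy_Schwarz_ineq_sum)
    finally show ?thesis
      by (simp add: norm_mult norm_power power_mult_distrib mult.commute flip: power_mult)
  qed
  have N: "0 < ?N"
    using nz by (intro sum_pos2[where i = i0]) auto
  have "norm z ^ (2 * l) * ?N = (\<Sum>i<n. norm z ^ (2 * l) * (norm (v i))\<^sup>2)"
    by (simp add: sum_distrib_left)
  also have "\<dots> \<le> (\<Sum>i<n. (\<Sum>j<n. (walk_sum M n l i j)\<^sup>2) * ?N)"
    by (intro sum_mono comp) simp
  also have "\<dots> = (\<Sum>i<n. \<Sum>j<n. (walk_sum M n l i j)\<^sup>2) * ?N"
    by (simp add: sum_distrib_right)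
  finally show ?thesis using N by simp
qed

lemma spectral_radius_power_le_walk_sums:
  fixes A :: "real mat"
  assumes A: "A \<in> carrier_mat n n" and n: "0 < n"
    and M: "\<And>i j. i < n \<Longrightarrow> j < n \<Longrightarrow> A $$ (i, j) = M (i, j)"
  shows "spectral_radius (map_mat complex_of_real A) ^ (2 * l)
      \<le> (\<Sum>i<n. \<Sum>j<n. (walk_sum M n l i j)\<^sup>2)"
proof -
  let ?A = "map_mat complex_of_real A"
  have car: "?A \<in> carrier_mat n n" using A by simp
  from spectral_radius_mem_max(1)[OF car n]
  obtain z where z: "z \<in> spectrum ?A" "spectral_radius ?A = norm z" by auto
  then obtain v where v: "eigenvector ?A v z" by (auto simp: spectrum_def eigenvalue_def)
  then have v: "v \<in> carrier_vec n" "v \<noteq> 0\<^sub>v n" "?A *\<^sub>v v = z \<cdot>\<^sub>v v"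
    using A by (auto simp: eigenvector_def)
  then obtain i0 where i0: "i0 < n" "v $ i0 \<noteq> 0"
    by (metis carrier_vecD eq_vecI index_zero_vec)
  have "(\<Sum>j<n. of_real (M (i, j)) * v $ j) = z * v $ i" if i: "i < n" for i
  proof -
    have "z * v $ i = (?A *\<^sub>v v) $ i" using v i by simp
    also have "\<dots> = (\<Sum>j<n. of_real (M (i, j)) * v $ j)"
      using A v(1) i M by (simp add: scalar_prod_def atLeast0LessThan)
    finally show ?thesis ..
  qed
  from eigenvalue_power_le_walk_sums[of n M "\<lambda>i. v $ i" z, OF this i0]
  show "spectral_radius ?A ^ (2 * l) \<le> (\<Sum>i<n. \<Sum>j<n. (walk_sum M n l i j)\<^sup>2)"
    unfolding z(2) .
qed

lemma sum_walk_sum_square: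
  "(\<Sum>i<n. \<Sum>j<n. (walk_sum M n l i j)\<^sup>2) =
     (\<Sum>i<n. \<Sum>xs\<in>words n l. \<Sum>ys\<in>words n l.
        of_bool (last (i # xs) = last (i # ys)) * prod_list (map M (walk_edges i xs @ walk_edges i ys)))"
proof (intro sum.cong refl)
  fix i assume "i \<in> {..<n}"
  then have i: "i < n" by simp
  let ?w = "\<lambda>xs. prod_list (map M (walk_edges i xs))"
  have "(\<Sum>j<n. (walk_sum M n l i j)\<^sup>2) = (\<Sum>j<n. \<Sum>xs\<in>words n l. \<Sum>ys\<in>words n l.
      of_bool (last (i # xs) = j) * (of_bool (last (i # ys) = j) * (?w xs * ?w ys)))"
    by (simp add: walk_sum_def power2_eq_square sum_product mult_ac
        del: last.simps sum_of_bool_mult_eq sum_mult_of_bool_eq)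
  also have "\<dots> = (\<Sum>xs\<in>words n l. \<Sum>ys\<in>words n l. \<Sum>j<n.
      of_bool (last (i # xs) = j) * (of_bool (last (i # ys) = j) * (?w xs * ?w ys)))"
    by (subst sum.swap, intro sum.cong refl, subst sum.swap) simp
  also have "\<dots> = (\<Sum>xs\<in>words n l. \<Sum>ys\<in>words n l.
      of_bool (last (i # xs) = last (i # ys)) * (?w xs * ?w ys))"
  proof (intro sum.cong refl)
    fix xs ys assume "xs \<in> words n l"
    then have "last (i # xs) < n" by (rule last_word_less[OF i])
    then show "(\<Sum>j<n. of_bool (last (i # xs) = j) * (of_bool (last (i # ys) = j) * (?w xs * ?w ys)))
        = of_bool (last (i # xs) = last (i # ys)) * (?w xs * ?w ys)"
      by (simp del: last.simps add: of_bool_def if_distrib[where f = "\<lambda>x. x * _"] cong: if_cong)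
  qed
  finally show "(\<Sum>j<n. (walk_sum M n l i j)\<^sup>2) = (\<Sum>xs\<in>words n l. \<Sum>ys\<in>words n l.
      of_bool (last (i # xs) = last (i # ys)) * prod_list (map M (walk_edges i xs @ walk_edges i ys)))"
    by simp
qed

section \<open>Moments of the centred edge indicators\<close>

definition centred_edge :: "(nat \<Rightarrow> nat \<Rightarrow> real) \<Rightarrow> real \<Rightarrow> (nat \<times> nat) \<Rightarrow> bool \<Rightarrow> real" where
  "centred_edge p d e x = (of_bool x - p (fst e) (snd e)) / sqrt d"

text \<open>
The quotient \<open>p / d\<close> dominates the variance, and every further power costs at most the maximal
modulus of the variable, which is at most \<open>1 / sqrt d\<close> and hence at most \<open>1 / q\<close>.
\<close>

lemma centred_edge_moment:
  assumes "0 \<le> p (fst e) (snd e)" "p (fst e) (snd e) \<le> 1" "1 \<le> q" "q \<le> sqrt d"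
  defines "E \<equiv> \<lambda>m. measure_pmf.expectation (bernoulli_pmf (p (fst e) (snd e))) (\<lambda>x. centred_edge p d e x ^ m)"
  shows "E 1 = 0"
    and "2 \<le> m \<Longrightarrow> \<bar>E m\<bar> \<le> (1 / q) ^ (m - 2) * (p (fst e) (snd e) / d)"
proof -
  define t where "t = p (fst e) (snd e)"
  have t: "0 \<le> t" "t \<le> 1" using assms by (auto simp: t_def)
  have E: "E m = ((1 - t) ^ m * t + (- t) ^ m * (1 - t)) / sqrt d ^ m" for m
    using t unfolding E_def centred_edge_def t_def[symmetric]
    by (simp add: power_divide add_divide_distrib)
  show "E 1 = 0" unfolding E by (simp add: algebra_simps)
  assume m: "2 \<le> m"
  have d: "0 < d" using assms(3,4) by (smt (verit) real_sqrt_gt_0_iff)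
  have "\<bar>(1 - t) ^ m * t + (- t) ^ m * (1 - t)\<bar> \<le> (1 - t) ^ m * t + t ^ m * (1 - t)"
    using t by (intro order_trans[OF abs_triangle_ineq]) (simp add: abs_mult power_abs)
  also have "\<dots> \<le> (1 - t) ^ 1 * t + t ^ 2 * (1 - t)"
    using t m by (intro add_mono mult_right_mono power_decreasing) auto
  also have "\<dots> \<le> t"
  proof -
    have "(1 - t) ^ 1 * t + t ^ 2 * (1 - t) = t - t ^ 3"
      by (simp add: power2_eq_square power3_eq_cube algebra_simps)
    then show ?thesis using t by simp
  qed
  finally have "\<bar>E m\<bar> \<le> t / sqrt d ^ m"
    using d by (simp add: E abs_divide divide_right_mono)
  also have "sqrt d ^ m = sqrt d ^ (m - 2) * d"
  proof -
    have "sqrt d ^ m = sqrt d ^ (m - 2) * (sqrt d)\<^sup>2"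
      unfolding power_add[symmetric] using m by (simp only: le_add_diff_inverse2)
    then show ?thesis using d by simp
  qed
  also have "t / (sqrt d ^ (m - 2) * d) = (1 / sqrt d) ^ (m - 2) * (t / d)"
    by (simp add: power_divide)
  also have "\<dots> \<le> (1 / q) ^ (m - 2) * (t / d)"
    using assms(3,4) t d by (intro mult_right_mono power_mono divide_left_mono mult_pos_pos) auto
  finally show "\<bar>E m\<bar> \<le> (1 / q) ^ (m - 2) * (p (fst e) (snd e) / d)"
    unfolding t_def .
qed

lemma prod_list_map_eq_prod_count:
  fixes f :: "'a \<Rightarrow> 'b :: comm_monoid_mult"
  assumes "finite A" "set zs \<subseteq> A"
  shows "prod_list (map f zs) = (\<Prod>e\<in>A. f e ^ count_list zs e)"
  using assms(2)
proof (induction zs)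
  case (Cons z zs)
  have "(\<Prod>e\<in>A. f e ^ count_list (z # zs) e) = (\<Prod>e\<in>A. (if z = e then f e else 1) * f e ^ count_list zs e)"
    by (intro prod.cong) auto
  also have "\<dots> = f z * (\<Prod>e\<in>A. f e ^ count_list zs e)"
    using assms(1) Cons.prems by (simp add: prod.distrib)
  finally show ?case using Cons by simp
qed simp

text \<open>
Centred variables take both signs, so integrability of the factors comes from the finiteness of
the supports.
\<close>

lemma expectation_prod_Pi_pmf_finite:
  fixes f :: "'a \<Rightarrow> 'b \<Rightarrow> real"
  assumes A: "finite A" and fin: "\<And>x. x \<in> A \<Longrightarrow> finite (set_pmf (p x))"
  shows "measure_pmf.expectation (Pi_pmf A dflt p) (\<lambda>g. \<Prod>x\<in>A. f x (g x))
    = (\<Prod>x\<in>A. measure_pmf.expectation (p x) (f x))"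
proof -
  let ?M = "measure_pmf (Pi_pmf A dflt p)"
  have comp: "map_pmf (\<lambda>g. g x) (Pi_pmf A dflt p) = p x" if "x \<in> A" for x
    using Pi_pmf_component[OF A, of x dflt p] that by simp
  have "prob_space.indep_vars ?M (\<lambda>_. count_space UNIV) (\<lambda>x g. g x) A"
    by (rule indep_vars_Pi_pmf[OF A])
  then have ind: "prob_space.indep_vars ?M (\<lambda>_. borel) (\<lambda>x g. f x (g x)) A"
    by (rule prob_space.indep_vars_compose2[OF measure_pmf.prob_space_axioms]) simp
  have "measure_pmf.expectation (Pi_pmf A dflt p) (\<lambda>g. \<Prod>x\<in>A. f x (g x))
      = (\<Prod>x\<in>A. measure_pmf.expectation (Pi_pmf A dflt p) (\<lambda>g. f x (g x)))"
  proof (rule prob_space.indep_vars_lebesgue_integral[OF measure_pmf.prob_space_axioms A ind])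
    fix x assume x: "x \<in> A"
    have "integrable (measure_pmf (map_pmf (\<lambda>g. g x) (Pi_pmf A dflt p))) (f x)"
      unfolding comp[OF x] by (intro integrable_measure_pmf_finite fin x)
    then show "integrable ?M (\<lambda>g. f x (g x))" by simp
  qed
  also have "\<dots> = (\<Prod>x\<in>A. measure_pmf.expectation (p x) (f x))"
  proof (intro prod.cong refl)
    fix x assume x: "x \<in> A"
    show "measure_pmf.expectation (Pi_pmf A dflt p) (\<lambda>g. f x (g x)) = measure_pmf.expectation (p x) (f x)"
      unfolding comp[OF x, symmetric] by simp
  qed
  finally show ?thesis .
qed

lemma finite_set_directed_ER: "finite (set_pmf (directed_ER n p))"
  unfolding directed_ER_def
  by (rule finite_subset[OF set_Pi_pmf_subset'])
     (auto intro!: finite_PiE_dflt intro: finite_subset[OF subset_UNIV])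

lemma integrable_directed_ER:
  fixes f :: "_ \<Rightarrow> real"
  shows "integrable (measure_pmf (directed_ER n p)) f"
  by (intro integrable_measure_pmf_finite finite_set_directed_ER)

text \<open>
Independence turns the expectation into a product over the distinct edges.  An edge that occurs
only once contributes its mean, which is zero.
\<close>

lemma expectation_edge_list:
  fixes q d :: real
  assumes p: "edge_probs n p" and q: "1 \<le> q" "q \<le> sqrt d" and zs: "set zs \<subseteq> {0..<n} \<times> {0..<n}"
  defines "E \<equiv> measure_pmf.expectation (directed_ER n p)
      (\<lambda>g. prod_list (map (\<lambda>e. centred_edge p d e (g e)) zs))"
  shows "\<exists>e\<in>set zs. count_list zs e < 2 \<Longrightarrow> E = 0"
    and "\<forall>e\<in>set zs. 2 \<le> count_list zs e \<Longrightarrow>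
      E \<le> (1 / q) ^ (length zs - 2 * card (set zs)) * (\<Prod>e\<in>set zs. p (fst e) (snd e) / d)"
proof -
  let ?A = "{0..<n} \<times> {0..<n}"
  let ?c = "count_list zs"
  let ?E = "\<lambda>e. measure_pmf.expectation (bernoulli_pmf (p (fst e) (snd e))) (\<lambda>x. centred_edge p d e x ^ ?c e)"
  have pe: "0 \<le> p (fst e) (snd e)" "p (fst e) (snd e) \<le> 1" if "e \<in> ?A" for e
    using p that by (auto simp: edge_probs_def)
  have "E = measure_pmf.expectation (directed_ER n p) (\<lambda>g. \<Prod>e\<in>?A. centred_edge p d e (g e) ^ ?c e)"
    using zs by (simp add: E_def prod_list_map_eq_prod_count[where A = ?A])
  also have "\<dots> = (\<Prod>e\<in>?A. ?E e)"
    unfolding directed_ER_def case_prod_unfold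
    by (rule expectation_prod_Pi_pmf_finite) (auto intro: finite_subset[OF subset_UNIV])
  also have "\<dots> = (\<Prod>e\<in>set zs. ?E e)"
    using zs by (intro prod.mono_neutral_right) (auto simp: count_list_0_iff)
  finally have eq: "E = (\<Prod>e\<in>set zs. ?E e)" .
  show "E = 0" if "\<exists>e\<in>set zs. ?c e < 2"
  proof -
    from that obtain e where e: "e \<in> set zs" "?c e < 2" by auto
    moreover have "?c e \<noteq> 0" using e by (simp add: count_list_0_iff)
    ultimately have "?c e = 1" by simp
    then have "?E e = 0" using centred_edge_moment(1)[where p = p and e = e, OF pe q] e zs by auto
    with e have "(\<Prod>e\<in>set zs. ?E e) = 0" by (intro prod_zero) auto
    with eq show ?thesis by simp
  qed
  assume True: "\<forall>e\<in>set zs. 2 \<le> ?c e"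
  have "(\<Prod>e\<in>set zs. ?E e) \<le> (\<Prod>e\<in>set zs. \<bar>?E e\<bar>)"
    unfolding abs_prod[symmetric] by (rule abs_ge_self)
  also have "\<dots> \<le> (\<Prod>e\<in>set zs. (1 / q) ^ (?c e - 2) * (p (fst e) (snd e) / d))"
    using True zs by (intro prod_mono conjI centred_edge_moment(2)[where p = p, OF pe q]) auto
  also have "\<dots> = (1 / q) ^ (\<Sum>e\<in>set zs. ?c e - 2) * (\<Prod>e\<in>set zs. p (fst e) (snd e) / d)"
    by (simp only: prod.distrib power_sum)
  also have "(\<Sum>e\<in>set zs. ?c e - 2) = length zs - 2 * card (set zs)"
    using True by (simp add: sum_subtractf_nat sum_count_set)
  finally show "E \<le> (1 / q) ^ (length zs - 2 * card (set zs)) * (\<Prod>e\<in>set zs. p (fst e) (snd e) / d)"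
    unfolding eq .
qed

section \<open>The expected sum over pairs of walks\<close>

text \<open>
The sum is over pairs of walks with a common start and a common end.  A pair with nonzero
expectation is bounded by the exploration weight of the two walks in succession.  For each of the
\<open>n\<close> starting points these weights add up to at most \<open>(1 + 1 / l)^(2 l)\<close>, which is at most \<open>exp 2\<close>.
\<close>

lemma expectation_walk_sums_le:
  fixes b q d :: real
  assumes p: "edge_probs n p" and q: "1 \<le> q" "q \<le> sqrt d"
    and row: "\<And>i. i < n \<Longrightarrow> (\<Sum>j<n. p i j) \<le> d"
    and pb: "\<And>i j. i < n \<Longrightarrow> j < n \<Longrightarrow> p i j / d \<le> b" and b: "0 < b"
    and l: "1 \<le> l" and small: "b * real (2 * l) ^ 7 * exp (4 * real l / q) \<le> 1"
  shows "measure_pmf.expectation (directed_ER n p)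
      (\<lambda>g. \<Sum>i<n. \<Sum>j<n. (walk_sum (\<lambda>e. centred_edge p d e (g e)) n l i j)\<^sup>2) \<le> exp 2 * n"
proof -
  let ?s = "\<lambda>e. p (fst e) (snd e) / d"
  let ?W = "explore_weight ?s b (2 * l)"
  let ?X = "\<lambda>g e. centred_edge p d e (g e)"
  let ?Ex = "measure_pmf.expectation (directed_ER n p)"
  have d: "0 < d" using q by (smt (verit) real_sqrt_gt_0_iff)
  have s0: "0 \<le> ?s (u, v)" if "u < n" "v < n" for u v
    using p d that by (auto simp: edge_probs_def)
  have rows: "(\<Sum>v<n. ?s (u, v)) \<le> 1" if "u < n" for u
    using row[OF that] d by (simp flip: sum_divide_distrib)
  have pb': "?s (u, v) \<le> b" if "u < n" "v < n" for u v using pb[OF that] by simp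
  have term_le: "?Ex (\<lambda>g. of_bool (last (i # xs) = last (i # ys)) *
        prod_list (map (?X g) (walk_edges i xs @ walk_edges i ys)))
      \<le> ?W i [] (walk_edges i xs) * ?W i (walk_edges i xs) (walk_edges i ys)"
    if i: "i < n" and xs: "xs \<in> words n l" and ys: "ys \<in> words n l" for i xs ys
  proof -
    let ?zs = "walk_edges i xs @ walk_edges i ys"
    have zs: "set ?zs \<subseteq> {0..<n} \<times> {0..<n}"
      using walk_edges_subset[OF i xs] walk_edges_subset[OF i ys] by simp
    have s0': "0 \<le> ?s e" if "e \<in> set ?zs" for e
      using zs that s0[of "fst e" "snd e"] by force
    have len: "length ?zs = 2 * l" using xs ys by (simp add: words_def)
    have W0: "0 \<le> ?W i [] ?zs" using s0' b by (intro explore_weight_nonneg) auto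
    have "?Ex (\<lambda>g. of_bool (last (i # xs) = last (i # ys)) * prod_list (map (?X g) ?zs)) \<le> ?W i [] ?zs"
    proof (cases "last (i # xs) = last (i # ys) \<and> (\<forall>e\<in>set ?zs. 2 \<le> count_list ?zs e)")
      case True
      have "visited i ?zs = set (i # xs) \<union> set (i # ys)"
        using arg_cong[OF map_snd_walk_edges[of i xs], of set]
          arg_cong[OF map_snd_walk_edges[of i ys], of set]
        by (auto simp: visited_def image_Un)
      also have "\<dots> \<subseteq> insert (last (i # xs)) (fst ` set ?zs)"
        using walk_edges_sources[of i xs] walk_edges_sources[of i ys] True by (auto simp: image_Un)
      finally have src: "visited i ?zs \<subseteq> insert (last (i # xs)) (fst ` set ?zs)" .
      have "?Ex (\<lambda>g. prod_list (map (?X g) ?zs))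
          \<le> (1 / q) ^ (length ?zs - 2 * card (set ?zs)) * (\<Prod>e\<in>set ?zs. ?s e)"
        using True by (intro expectation_edge_list(2)[OF p q zs]) simp
      also have "\<dots> \<le> ?W i [] ?zs" unfolding len
        using True by (intro walk_pair_term_le_explore_weight[OF s0' b q(1) len l _ src small]) auto
      finally show ?thesis using True by simp
    next
      case False
      then show ?thesis
      proof (cases "last (i # xs) = last (i # ys)")
        case True
        with False have "\<exists>e\<in>set ?zs. count_list ?zs e < 2" by (simp add: not_le)
        from expectation_edge_list(1)[OF p q zs this] True W0 show ?thesis by simp
      qed (use W0 in simp)
    qed
    then show ?thesis by (simp add: explore_weight_append)
  qed
  have L: "(1 + 2 / (2 * l)) ^ (2 * l) \<le> exp (2 :: real)"
  proof -
    have "(1 + 2 / real (2 * l)) ^ (2 * l) \<le> exp (2 / real (2 * l)) ^ (2 * l)"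
      by (intro power_mono exp_ge_add_one_self) auto
    also have "\<dots> = exp 2" using l by (simp flip: exp_of_nat_mult)
    finally show ?thesis .
  qed
  note wsum = sum_explore_weight_le[where s = ?s and b = b and n = n and L = "2 * l" and l = l,
      OF s0 pb' rows b]
  have "?Ex (\<lambda>g. \<Sum>i<n. \<Sum>j<n. (walk_sum (?X g) n l i j)\<^sup>2)
      = (\<Sum>i<n. \<Sum>xs\<in>words n l. \<Sum>ys\<in>words n l. ?Ex (\<lambda>g. of_bool (last (i # xs) = last (i # ys)) *
          prod_list (map (?X g) (walk_edges i xs @ walk_edges i ys))))"
    unfolding sum_walk_sum_square
    by (simp only: Bochner_Integration.integral_sum integrable_directed_ER)
  also have "\<dots> \<le> (\<Sum>i<n. \<Sum>xs\<in>words n l. \<Sum>ys\<in>words n l.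
      ?W i [] (walk_edges i xs) * ?W i (walk_edges i xs) (walk_edges i ys))"
    by (intro sum_mono term_le) auto
  also have "\<dots> = (\<Sum>i<n. \<Sum>xs\<in>words n l. ?W i [] (walk_edges i xs) *
      (\<Sum>ys\<in>words n l. ?W i (walk_edges i xs) (walk_edges i ys)))"
    by (simp add: sum_distrib_left)
  also have "\<dots> \<le> (\<Sum>i<n. \<Sum>xs\<in>words n l. ?W i [] (walk_edges i xs) * (1 + 2 / (2 * l)) ^ l)"
  proof (intro sum_mono mult_left_mono)
    fix i xs assume i: "i \<in> {..<n}" and xs: "xs \<in> words n l"
    show "(\<Sum>ys\<in>words n l. ?W i (walk_edges i xs) (walk_edges i ys)) \<le> (1 + 2 / (2 * l)) ^ l"
      using i xs wsum[of i "walk_edges i xs" i] by (simp add: words_def)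
    have "0 \<le> ?s e" if "e \<in> set (walk_edges i xs)" for e
      using walk_edges_subset[of i n xs l] i xs that s0[of "fst e" "snd e"] by force
    then show "0 \<le> ?W i [] (walk_edges i xs)" using b by (intro explore_weight_nonneg) auto
  qed
  also have "\<dots> = (\<Sum>i<n. (\<Sum>xs\<in>words n l. ?W i [] (walk_edges i xs)) * (1 + 2 / (2 * l)) ^ l)"
    by (simp add: sum_distrib_right)
  also have "\<dots> \<le> (\<Sum>i<n. (1 + 2 / (2 * l)) ^ l * (1 + 2 / (2 * l)) ^ l)"
  proof (intro sum_mono mult_right_mono)
    fix i assume i: "i \<in> {..<n}"
    show "(\<Sum>xs\<in>words n l. ?W i [] (walk_edges i xs)) \<le> (1 + 2 / (2 * l)) ^ l"
      using i wsum[of i "[]" i] by simp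
  qed auto
  also have "\<dots> = n * (1 + 2 / (2 * l)) ^ (2 * l)"
    by (simp flip: power_add mult_2)
  also have "\<dots> \<le> n * exp 2" using L by (intro mult_left_mono) auto
  finally show ?thesis by (simp add: mult.commute)
qed

section \<open>Tail bounds for the spectral radius\<close>

lemma mean_adjacency_entry:
  assumes p: "edge_probs n p" and ij: "i < n" "j < n"
  shows "mean_adjacency n p $$ (i, j) = p i j"
proof -
  have p01: "0 \<le> p i j" "p i j \<le> 1" using p ij by (auto simp: edge_probs_def)
  have "mean_adjacency n p $$ (i, j)
      = measure_pmf.expectation (directed_ER n p) (\<lambda>g. of_bool (g (i, j)))"
    using ij by (simp add: mean_adjacency_def adjacency_def of_bool_def)
  also have "\<dots> = measure_pmf.expectation (map_pmf (\<lambda>g. g (i, j)) (directed_ER n p)) of_bool"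
    by simp
  also have "map_pmf (\<lambda>g. g (i, j)) (directed_ER n p) = bernoulli_pmf (p i j)"
    unfolding directed_ER_def using ij by (subst Pi_pmf_component) auto
  finally show ?thesis using p01 by simp
qed

lemma normalized_adjacency_entry:
  assumes "edge_probs n p" "0 < max_degree n p" "i < n" "j < n"
  shows "normalized_adjacency n p g $$ (i, j) = centred_edge p (max_degree n p) (i, j) (g (i, j))"
proof -
  have "adjacency n g \<in> carrier_mat n n" "mean_adjacency n p \<in> carrier_mat n n"
    by (auto simp: adjacency_def mean_adjacency_def)
  then show ?thesis
    using assms mean_adjacency_entry[OF assms(1,3,4)]
    by (auto simp: normalized_adjacency_def centred_edge_def adjacency_def powr_minus_divide powr_half_sqrt)
qed

lemma spectral_radius_tail_le:
  assumes p: "edge_probs n p" and n: "1 \<le> n" and d: "0 < max_degree n p" and t: "0 < t"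
  shows "spectral_radius_tail n p t * t ^ (2 * l) \<le> measure_pmf.expectation (directed_ER n p)
      (\<lambda>g. \<Sum>i<n. \<Sum>j<n. (walk_sum (\<lambda>e. centred_edge p (max_degree n p) e (g e)) n l i j)\<^sup>2)"
proof -
  let ?E = "measure_pmf.expectation (directed_ER n p)"
  let ?f = "\<lambda>g. \<Sum>i<n. \<Sum>j<n. (walk_sum (\<lambda>e. centred_edge p (max_degree n p) e (g e)) n l i j)\<^sup>2"
  let ?S = "{g. t \<le> spectral_radius (map_mat complex_of_real (normalized_adjacency n p g))}"
  have f: "t ^ (2 * l) * indicator ?S g \<le> ?f g" for g
  proof (cases "g \<in> ?S")
    case True
    have car: "normalized_adjacency n p g \<in> carrier_mat n n"
      by (auto simp: normalized_adjacency_def adjacency_def mean_adjacency_def)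
    from True t have "t ^ (2 * l)
        \<le> spectral_radius (map_mat complex_of_real (normalized_adjacency n p g)) ^ (2 * l)"
      by (intro power_mono) auto
    also have "\<dots> \<le> ?f g"
      using n by (intro spectral_radius_power_le_walk_sums[OF car] normalized_adjacency_entry p d) auto
    finally show ?thesis using True by simp
  qed (simp add: sum_nonneg)
  have "spectral_radius_tail n p t * t ^ (2 * l) = ?E (\<lambda>g. t ^ (2 * l) * indicator ?S g)"
    by (simp add: spectral_radius_tail_def mult.commute)
  also have "\<dots> \<le> ?E ?f"
    by (intro integral_mono integrable_directed_ER f)
  finally show ?thesis .
qed

lemma row_sum_le_max_degree: "i < n \<Longrightarrow> (\<Sum>j<n. p i j) \<le> max_degree n p"
  unfolding max_degree_def by (intro Max_ge) auto

lemma le_max_prob: "i < n \<Longrightarrow> j < n \<Longrightarrow> p i j \<le> max_prob n p"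
  unfolding max_prob_def by (intro Max_ge) force+

lemma max_prob_pos:
  assumes "1 \<le> n" "0 < max_degree n p"
  shows "0 < max_prob n p"
proof (rule ccontr)
  assume "\<not> 0 < max_prob n p"
  then have "p i j \<le> 0" if "i < n" "j < n" for i j using le_max_prob[OF that, of p] by simp
  then have "(\<Sum>j<n. p i j) \<le> 0" if "i < n" for i using that by (intro sum_nonpos) auto
  moreover have "max_degree n p \<in> (\<lambda>i. \<Sum>j<n. p i j) ` {..<n}"
    unfolding max_degree_def using assms(1) by (intro Max_in) (auto simp: lessThan_empty_iff)
  ultimately show False using assms(2) by force
qed

text \<open>
Markov's inequality is applied with a walk length \<open>l\<close> of order \<open>m = c q ln n\<close> such that
\<open>2 l \<ge> m\<close>, which makes \<open>t^(2 l)\<close> at least \<open>n^(c q ln t)\<close>.  For \<open>m > 2\<close> the factor \<open>(2 l)^7\<close> is at most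
\<open>q^7 n^(7/100)\<close>, and \<open>exp (4 l / q)\<close> is at most \<open>n^(1/50)\<close>.  The constant \<open>c\<close> is chosen so that these
two powers of \<open>n\<close> stay below the margin \<open>n^(1/10)\<close> that the sparsity hypothesis leaves.
\<close>

lemma tail_bound_of_sparse:
  fixes q t :: real
  defines "c \<equiv> 1 / 400"
  assumes p: "edge_probs n p" and n: "1 \<le> n" and d: "0 < max_degree n p"
    and q: "1 \<le> q" "q \<le> sqrt (max_degree n p)"
    and sparse: "max_prob n p / max_degree n p * q ^ 7 \<le> n powr (-1/10)"
    and t: "1 \<le> t"
  shows "spectral_radius_tail n p t \<le> exp 2 * n powr (2 - c * q * ln t)"
proof -
  define d' where "d' = max_degree n p"
  define b where "b = max_prob n p / d'"
  define P where "P = spectral_radius_tail n p t"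
  define m where "m = c * q * ln n"
  define l where "l = (if m \<le> 2 then 1 else nat \<lceil>m\<rceil>)"
  have P: "0 \<le> P" by (simp add: P_def spectral_radius_tail_def)
  have b: "0 < b" using max_prob_pos[OF n d] d by (simp add: b_def d'_def)
  have pd: "p i j / d' \<le> b" if "i < n" "j < n" for i j
    using le_max_prob[OF that, of p] d by (simp add: b_def d'_def divide_right_mono)
  have ml: "m \<le> 2 * l"
    using le_of_int_ceiling[of m] unfolding l_def by (cases "m \<le> 2") (simp, simp, linarith)
  have tail: "P * t ^ (2 * l) \<le> exp 2 * n ^ 2"
  proof (cases "m \<le> 2")
    case True
    \<comment> \<open>Walks of length one suffice, because \<open>m\<close> is at most two and
      all entries of the matrix are at most one in modulus.\<close>
    have "P * t ^ (2 * l) \<le> measure_pmf.expectation (directed_ER n p)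
      (\<lambda>g. \<Sum>i<n. \<Sum>j<n. (walk_sum (\<lambda>e. centred_edge p d' e (g e)) n l i j)\<^sup>2)"
      unfolding P_def d'_def using t by (intro spectral_radius_tail_le p n d) auto
    also have "\<dots> \<le> measure_pmf.expectation (directed_ER n p) (\<lambda>g. real n ^ 2)"
    proof (intro integral_mono integrable_directed_ER)
      fix g
      have "(walk_sum (\<lambda>e. centred_edge p d' e (g e)) n l i j)\<^sup>2 \<le> 1" if ij: "i < n" "j < n" for i j
      proof -
        have "walk_sum (\<lambda>e. centred_edge p d' e (g e)) n l i j = centred_edge p d' (i, j) (g (i, j))"
          using True ij by (simp add: l_def walk_sum_def sum_words_Suc[of _ _ 0, simplified]
              of_bool_def if_distrib[where f = "\<lambda>x. x * _"] cong: if_cong)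
        moreover have "\<bar>centred_edge p d' (i, j) (g (i, j))\<bar> \<le> 1"
        proof -
          have "\<bar>of_bool (g (i, j)) - p i j\<bar> \<le> 1"
            using p ij by (cases "g (i, j)") (auto simp: edge_probs_def)
          also have "1 \<le> sqrt d'" using order_trans[OF q] by (simp add: d'_def)
          finally have le: "\<bar>of_bool (g (i, j)) - p i j\<bar> \<le> sqrt d'" .
          have "\<bar>centred_edge p d' (i, j) (g (i, j))\<bar> = \<bar>of_bool (g (i, j)) - p i j\<bar> / sqrt d'"
            unfolding centred_edge_def using d by (simp only: abs_divide d'_def) simp
          also have "\<dots> \<le> 1"
            by (subst divide_le_eq_1_pos) (use d in \<open>simp add: d'_def\<close>, fact le)
          finally show ?thesis .
        qed
        ultimately show ?thesis by (simp add: abs_square_le_1)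
      qed
      then have "(\<Sum>i<n. \<Sum>j<n. (walk_sum (\<lambda>e. centred_edge p d' e (g e)) n l i j)\<^sup>2)
          \<le> (\<Sum>i<n. \<Sum>j<n. 1)" by (intro sum_mono) auto
      then show "(\<Sum>i<n. \<Sum>j<n. (walk_sum (\<lambda>e. centred_edge p d' e (g e)) n l i j)\<^sup>2) \<le> real n ^ 2"
        by (simp add: power2_eq_square)
    qed
    also have "\<dots> \<le> exp 2 * n ^ 2" by (simp add: mult_left_le_one_le mult_le_cancel_right1)
    finally show ?thesis .
  next
    case False
    have l: "1 \<le> l" "2 * l \<le> 4 * m" using False unfolding l_def by (auto simp: of_nat_ceiling) linarith+
    have n1: "1 \<le> real n" using n by simp
    have "ln (real n) = 100 * ln (real n powr (1/100))" using n1 by (simp add: ln_powr)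
    also have "\<dots> \<le> 100 * real n powr (1/100)"
      using n1 ln_le_minus_one[of "real n powr (1/100)"] by simp
    finally have ln100: "ln (real n) / 100 \<le> real n powr (1/100)" by simp
    have "real (2 * l) \<le> q * (ln n / 100)" using l by (simp add: m_def c_def)
    also have "\<dots> \<le> q * n powr (1/100)" using ln100 q by (intro mult_left_mono) auto
    finally have "real (2 * l) ^ 7 \<le> (q * n powr (1/100)) ^ 7" by (intro power_mono) auto
    also have "\<dots> = q ^ 7 * n powr (7/100)"
      using n1 by (simp add: power_mult_distrib powr_power)
    finally have L7: "real (2 * l) ^ 7 \<le> q ^ 7 * n powr (7/100)" .
    have "4 * l / q \<le> ln n / 50" using l q by (simp add: m_def c_def field_simps)
    then have "exp (4 * real l / q) \<le> exp (ln n / 50)" by simp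
    also have "\<dots> = n powr (1/50)" using n1 by (simp add: powr_def)
    finally have ex: "exp (4 * real l / q) \<le> n powr (1/50)" .
    have "b * real (2 * l) ^ 7 * exp (4 * real l / q) \<le> b * (q ^ 7 * n powr (7/100)) * n powr (1/50)"
      using L7 ex b q by (intro mult_mono mult_left_mono) auto
    also have "\<dots> = (b * q ^ 7) * (n powr (7/100) * n powr (1/50))" by simp
    also have "\<dots> \<le> n powr (-1/10) * (n powr (7/100) * n powr (1/50))"
      using sparse by (intro mult_right_mono) (auto simp: b_def d'_def)
    also have "\<dots> = n powr (-1/100)" by (simp flip: powr_add)
    also have "\<dots> \<le> 1" using n1 powr_mono[of "-1/100" 0 "real n"] by simp
    finally have small: "b * real (2 * l) ^ 7 * exp (4 * real l / q) \<le> 1" .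
    have "P * t ^ (2 * l) \<le> measure_pmf.expectation (directed_ER n p)
      (\<lambda>g. \<Sum>i<n. \<Sum>j<n. (walk_sum (\<lambda>e. centred_edge p d' e (g e)) n l i j)\<^sup>2)"
      unfolding P_def d'_def using t by (intro spectral_radius_tail_le p n d) auto
    also have "\<dots> \<le> exp 2 * n"
      using q row_sum_le_max_degree[of _ n p] pd
      by (intro expectation_walk_sums_le[OF p q(1) _ _ _ b l(1) small]) (auto simp: d'_def)
    also have "\<dots> \<le> exp 2 * n ^ 2" using n1 by (simp add: power2_eq_square)
    finally show ?thesis .
  qed
  have "t powr m \<le> t powr (2 * l)" using ml t by (intro powr_mono) auto
  also have "\<dots> = t ^ (2 * l)" using t by (simp flip: powr_realpow)
  finally have "P * t powr m \<le> exp 2 * n ^ 2" using P tail by (smt (verit) mult_left_mono)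
  then have "P \<le> exp 2 * n ^ 2 / t powr m" using t by (simp add: field_simps)
  also have "t powr m = n powr (c * q * ln t)"
    using n t by (simp add: powr_def m_def mult_ac)
  also have "exp 2 * n ^ 2 / n powr (c * q * ln t) = exp 2 * n powr (2 - c * q * ln t)"
    using n by (simp add: powr_diff)
  finally show ?thesis by (simp add: P_def)
qed

lemma sparse_of_q_param:
  assumes n: "1 \<le> n" and d: "0 < max_degree n p" and q: "1 \<le> q_param n p"
  shows "max_prob n p / max_degree n p * q_param n p ^ 7 \<le> n powr (-1/10)"
proof -
  define b where "b = max_prob n p / max_degree n p"
  define q where "q = q_param n p"
  have b: "0 < b" using max_prob_pos[OF n d] d by (simp add: b_def)
  have k: "kappa n p = n * b" using n d by (simp add: kappa_def b_def)
  have q1: "1 \<le> q" using q by (simp add: q_def)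
  have "q \<le> n powr (1/10) * (n * b) powr (-1/9)" unfolding q_def q_param_def k by simp
  then have "q ^ 9 \<le> (n powr (1/10) * (n * b) powr (-1/9)) ^ 9" using q1 by (intro power_mono) auto
  also have "\<dots> = n powr (9/10) / (n * b)"
    using n b by (simp add: power_mult_distrib powr_power powr_minus_divide power_divide)
  finally have "b * q ^ 9 \<le> b * (n powr (9/10) / (n * b))" using b by (intro mult_left_mono) auto
  also have "\<dots> = n powr (9/10 - 1)" using n b powr_diff[of "real n" "9/10" 1] by simp
  finally have "b * q ^ 9 \<le> n powr (-1/10)" by simp
  moreover have "b * q ^ 7 \<le> b * q ^ 9" using b q1 by (intro mult_left_mono power_increasing) auto
  ultimately show ?thesis by (simp add: b_def q_def)
qed

theorem theorem3p4:
  shows "\<exists>C c :: real. C > 0 \<and> c > 0 \<and>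
    (\<forall>(n :: nat) (p :: nat \<Rightarrow> nat \<Rightarrow> real).
       n \<ge> 1 \<longrightarrow> edge_probs n p \<longrightarrow> max_degree n p > 0 \<longrightarrow>
       (q_param n p \<ge> 1 \<longrightarrow>
          (\<forall>\<epsilon>\<ge>0. spectral_radius_tail n p (1 + \<epsilon>)
                    \<le> C * real n powr (2 - c * q_param n p * ln (1 + \<epsilon>)))) \<and>
       (max_degree n p \<ge> 1 \<and>
        max_degree n p powr (7/2) * max_prob n p \<le> real n powr (-1/10) \<longrightarrow>
          (\<forall>\<epsilon>\<ge>0. spectral_radius_tail n p (1 + \<epsilon>)
                    \<le> C * real n powr (2 - c * sqrt (max_degree n p) * ln (1 + \<epsilon>)))))"
proof (rule exI[of _ "exp 2"], rule exI[of _ "1 / 400"], intro conjI allI impI)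
  fix n :: nat and p :: "nat \<Rightarrow> nat \<Rightarrow> real" and \<epsilon> :: real
  assume n: "n \<ge> 1" and p: "edge_probs n p" and d: "max_degree n p > 0" and \<epsilon>: "\<epsilon> \<ge> 0"
  assume q: "q_param n p \<ge> 1"
  show "spectral_radius_tail n p (1 + \<epsilon>) \<le> exp 2 * real n powr (2 - 1 / 400 * q_param n p * ln (1 + \<epsilon>))"
    using \<epsilon> by (intro tail_bound_of_sparse p n d q sparse_of_q_param) (auto simp: q_param_def)
next
  fix n :: nat and p :: "nat \<Rightarrow> nat \<Rightarrow> real" and \<epsilon> :: real
  assume n: "n \<ge> 1" and p: "edge_probs n p" and d: "max_degree n p > 0" and \<epsilon>: "\<epsilon> \<ge> 0"
  assume hyp: "max_degree n p \<ge> 1 \<and> max_degree n p powr (7/2) * max_prob n p \<le> real n powr (-1/10)"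
  define D where "D = max_degree n p"
  have D: "1 \<le> D" using hyp by (simp add: D_def)
  have pow: "sqrt D ^ 7 = D powr (7/2)" using D by (simp add: powr_power flip: powr_half_sqrt)
  have "max_prob n p / D * sqrt D ^ 7 \<le> max_prob n p * sqrt D ^ 7"
    using max_prob_pos[OF n d] D by (intro mult_right_mono) (auto simp: divide_le_eq mult_le_cancel_left1)
  also have "\<dots> \<le> n powr (-1/10)"
    using hyp unfolding pow by (simp add: D_def mult.commute)
  finally have sparse: "max_prob n p / D * sqrt D ^ 7 \<le> n powr (-1/10)" .
  show "spectral_radius_tail n p (1 + \<epsilon>)
      \<le> exp 2 * real n powr (2 - 1 / 400 * sqrt (max_degree n p) * ln (1 + \<epsilon>))"
    using \<epsilon> D sparse unfolding D_def by (intro tail_bound_of_sparse p n d) auto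
qed auto

end
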